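(* Let $N\ge 1$ and let $\Sigma=\{E_1,\dots,E_{N+1}\}$ be a set of real numbers that is symmetric about the origin (if $E\in\Sigma$ then $-E\in\Sigma$) but otherwise arbitrary. For nonzero real numbers $F_1,\dots,F_N$ let $H$ be the $(N+1)\times(N+1)$ real symmetric tridiagonal matrix with zero diagonal and $H_{n,n+1}=H_{n+1,n}=F_n$ for $1\le n\le N$. Equating the coefficients of the characteristic polynomial $\det(H+\lambda\mathbf 1)$, which are polynomials in $F_1,\dots,F_N$, with those of $\prod_{k=1}^{N+1}(\lambda+E_k)$ gives a set of $\lfloor (N+1)/2\rfloor$ equations for the $N$ unknowns $F_1,\dots,F_N$. This leaves $N-\lfloor (N+1)/2\rfloor=\lfloor N/2\rfloor$ free variables, and consequently the set of all couplings $(F_1,\dots,F_N)$ for which $H$ has spectrum $\Sigma$ is a $\lfloor N/2\rfloor$-dimensional surface in the space of couplings.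
   Context: $\mathbf 1$ is the $(N+1)\times(N+1)$ identity matrix and $\lfloor\cdot\rfloor$ is the integer part. "$\lfloor N/2\rfloor$-dimensional surface" is meant in the sense of counting equations against unknowns: the set is the common solution set of $\lfloor (N+1)/2\rfloor$ polynomial equations in $N$ variables. No smoothness or embeddedness is asserted. *)

theory Defs
  imports "HOL-Library.Poly_Mapping" "Jordan_Normal_Form.Char_Poly" "Jordan_Normal_Form.Spectral_Radius"
begin

text \<open>Real polynomials in indeterminates indexed by the natural numbers: finitely supported
  functions from monomials (finitely supported exponent functions) to coefficients.\<close>

type_synonym rmpoly = "(nat \<Rightarrow>\<^sub>0 nat) \<Rightarrow>\<^sub>0 real"

definition mvar :: "nat \<Rightarrow> rmpoly" where
  "mvar i = Poly_Mapping.single (Poly_Mapping.single i 1) 1"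

definition mconst :: "real \<Rightarrow> rmpoly" where
  "mconst c = Poly_Mapping.single 0 c"

definition mvars :: "rmpoly \<Rightarrow> nat set" where
  "mvars p = (\<Union>m\<in>Poly_Mapping.keys p. Poly_Mapping.keys m)"

definition meval :: "(nat \<Rightarrow> real) \<Rightarrow> rmpoly \<Rightarrow> real" where
  "meval F p = (\<Sum>m\<in>Poly_Mapping.keys p. Poly_Mapping.lookup p m *
     (\<Prod>i\<in>Poly_Mapping.keys m. F i ^ Poly_Mapping.lookup m i))"

text \<open>Matrix indices start at 0, couplings are numbered from 1: the entry \<open>H\<^sub>n\<^sub>,\<^sub>n\<^sub>+\<^sub>1\<close> sits at position
  \<open>(n - 1, n)\<close>.  The definition is polymorphic so that it applies both to real couplings and to
  indeterminates.\<close>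

definition hop_mat :: "nat \<Rightarrow> (nat \<Rightarrow> 'a::zero) \<Rightarrow> 'a mat" where
  "hop_mat N F = mat (N + 1) (N + 1)
     (\<lambda>(i, j). if j = Suc i then F j else if i = Suc j then F i else 0)"

text \<open>\<open>det (A + \<lambda> 1)\<close> as a polynomial in \<open>\<lambda>\<close>; the library's \<^const>\<open>char_poly\<close> is \<open>det (\<lambda> 1 - A)\<close>.\<close>

definition det_plus :: "'a::comm_ring_1 mat \<Rightarrow> 'a poly" where
  "det_plus A = det (map_mat (\<lambda>a. [:a:]) A + [:0, 1:] \<cdot>\<^sub>m 1\<^sub>m (dim_row A))"

text \<open>The coefficients of \<open>det (H + \<lambda> 1)\<close> as polynomials in the couplings.\<close>

definition coeff_poly :: "nat \<Rightarrow> nat \<Rightarrow> rmpoly" where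
  "coeff_poly N j = coeff (det_plus (hop_mat N mvar)) j"

definition target_poly :: "nat \<Rightarrow> (nat \<Rightarrow> real) \<Rightarrow> real poly" where
  "target_poly N E = (\<Prod>k = 1..N + 1. [:E k, 1:])"

text \<open>The equations \<open>p = 0\<close> obtained by equating coefficients, identified with their left-hand
  sides \<open>p\<close>.  Coefficients that agree identically yield \<open>0 = 0\<close>, which is not counted as an
  equation.\<close>

definition coeff_eqs :: "nat \<Rightarrow> (nat \<Rightarrow> real) \<Rightarrow> rmpoly set" where
  "coeff_eqs N E =
     {coeff_poly N j - mconst (coeff (target_poly N E) j) | j. j \<le> N + 1} - {0}"

definition couplings :: "nat \<Rightarrow> (nat \<Rightarrow> real) set" where
  "couplings N = {1..N} \<rightarrow>\<^sub>E - {0}"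

text \<open>Dimension in the sense of counting equations against unknowns: \<open>S\<close> is the common solution
  set, in the space of couplings, of the polynomial equations \<open>P\<close> in the \<open>N\<close> variables, and the
  number of equations is \<open>N - d\<close>.  The equations are a parameter rather than existentially
  quantified, because over the reals any finite system can be merged into one equation.\<close>

definition counting_surface :: "nat \<Rightarrow> rmpoly set \<Rightarrow> nat \<Rightarrow> (nat \<Rightarrow> real) set \<Rightarrow> bool" where
  "counting_surface N P d S \<longleftrightarrow>
     finite P \<and> (\<forall>p\<in>P. mvars p \<subseteq> {1..N}) \<and> card P + d = N \<and>
     S = {F \<in> couplings N. \<forall>p\<in>P. meval F p = 0}"

end

theory Submission imports Defs begin

text \<open>Expanding along the last row gives the three-term recurrence
  \<open>P\<^sub>n\<^sub>+\<^sub>2 = \<lambda> P\<^sub>n\<^sub>+\<^sub>1 - F\<^sub>n\<^sub>+\<^sub>1\<^sup>2 P\<^sub>n\<close> for \<open>det (H + \<lambda> 1)\<close>, so its coefficients vanish in every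
  degree of the wrong parity; by symmetry of the spectrum so do those of the target polynomial.
  The degree \<open>N + 1\<close> gives \<open>1 = 1\<close>, and the degrees \<open>N + 1 - 2k\<close> with \<open>1 \<le> k \<le> (N + 1) div 2\<close>
  remain.  Setting all couplings equal to \<open>t\<close> turns the coefficient in degree \<open>N + 1 - 2k\<close> into a
  nonzero multiple of \<open>t\<^sup>2\<^sup>k\<close>, which shows that these equations are nonconstant and pairwise
  distinct.  Since \<open>\<Sigma>\<close> has \<open>N + 1\<close> elements, the spectrum determines the monic polynomial
  \<open>det (H + \<lambda> 1)\<close>.\<close>

section \<open>Evaluation of polynomials\<close>

definition monom_eval :: "(nat \<Rightarrow> real) \<Rightarrow> (nat \<Rightarrow>\<^sub>0 nat) \<Rightarrow> real" where
  "monom_eval F m = (\<Prod>i\<in>Poly_Mapping.keys m. F i ^ Poly_Mapping.lookup m i)"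

text \<open>Outside the support the exponent is 0, so the extra factors are 1 even where
  \<open>F\<close> vanishes; two monomials can thus be evaluated over a common index set.\<close>

lemma monom_eval_superset:
  assumes "finite A" "Poly_Mapping.keys m \<subseteq> A"
  shows "monom_eval F m = (\<Prod>i\<in>A. F i ^ Poly_Mapping.lookup m i)"
  unfolding monom_eval_def
  by (rule prod.mono_neutral_left) (use assms in \<open>auto simp: in_keys_iff\<close>)

lemma monom_eval_add: "monom_eval F (m + n) = monom_eval F m * monom_eval F n"
proof -
  let ?A = "Poly_Mapping.keys m \<union> Poly_Mapping.keys n"
  have "monom_eval F (m + n) = (\<Prod>i\<in>?A. F i ^ Poly_Mapping.lookup (m + n) i)"
    by (rule monom_eval_superset) (auto simp: in_keys_iff lookup_add)
  also have "\<dots> = (\<Prod>i\<in>?A. F i ^ Poly_Mapping.lookup m i) * (\<Prod>i\<in>?A. F i ^ Poly_Mapping.lookup n i)"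
    by (simp add: lookup_add power_add prod.distrib)
  also have "\<dots> = monom_eval F m * monom_eval F n"
    by (subst (1 2) monom_eval_superset[where A = ?A]) auto
  finally show ?thesis .
qed

lemma meval_superset:
  assumes "finite A" "Poly_Mapping.keys p \<subseteq> A"
  shows "meval F p = (\<Sum>m\<in>A. Poly_Mapping.lookup p m * monom_eval F m)"
  unfolding meval_def monom_eval_def[symmetric]
  by (rule sum.mono_neutral_left) (use assms in \<open>auto simp: in_keys_iff\<close>)

lemma meval_single: "meval F (Poly_Mapping.single m c) = c * monom_eval F m"
  by (subst meval_superset[where A = "{m}"]) auto

lemma meval_0 [simp]: "meval F 0 = 0"
  by (simp add: meval_def)

lemma meval_add: "meval F (p + q) = meval F p + meval F q"
proof -
  let ?A = "Poly_Mapping.keys p \<union> Poly_Mapping.keys q"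
  have "meval F (p + q) = (\<Sum>m\<in>?A. Poly_Mapping.lookup (p + q) m * monom_eval F m)"
    by (rule meval_superset) (auto simp: in_keys_iff lookup_add)
  also have "\<dots> = (\<Sum>m\<in>?A. Poly_Mapping.lookup p m * monom_eval F m)
      + (\<Sum>m\<in>?A. Poly_Mapping.lookup q m * monom_eval F m)"
    by (simp add: lookup_add distrib_right sum.distrib)
  also have "\<dots> = meval F p + meval F q"
    by (subst (1 2) meval_superset[where A = ?A]) auto
  finally show ?thesis .
qed

lemma meval_diff: "meval F (p - q) = meval F p - meval F q"
  using meval_add[of F "p - q" q] by simp

lemma meval_uminus: "meval F (- p) = - meval F p"
  using meval_diff[of F 0 p] by simp

text \<open>An update at a key outside the support amounts to adding a single term, which gives an
  induction suited to additive maps.\<close>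

lemma poly_mapping_add_single_induct [case_names zero add_single]:
  fixes P :: "('a \<Rightarrow>\<^sub>0 'b::monoid_add) \<Rightarrow> bool"
  assumes "P 0" and add: "\<And>p m c. P p \<Longrightarrow> P (p + Poly_Mapping.single m c)"
  shows "P p"
proof (induction p rule: update_induct)
  case (update p m c)
  have "Poly_Mapping.update m c p = p + Poly_Mapping.single m c"
    using update(1) by (intro poly_mapping_eqI)
      (auto simp: lookup_update lookup_add lookup_single in_keys_iff when_def)
  with add[OF update(3)] show ?case by simp
qed (rule assms)

text \<open>Additivity in each factor reduces the claim to two single terms, where it is
  \<open>monom_eval_add\<close>.\<close>

lemma meval_mult: "meval F (p * q) = meval F p * meval F q"
proof (induction p rule: poly_mapping_add_single_induct)
  case (add_single p m c)
  have "meval F (Poly_Mapping.single m c * q) = meval F (Poly_Mapping.single m c) * meval F q"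
    by (induction q rule: poly_mapping_add_single_induct)
      (simp_all add: distrib_left meval_add mult_single meval_single monom_eval_add)
  with add_single show ?case by (simp add: distrib_right meval_add)
qed simp

lemma meval_mvar [simp]: "meval F (mvar i) = F i"
  by (simp add: mvar_def meval_single monom_eval_def)

lemma meval_mconst [simp]: "meval F (mconst c) = c"
  by (simp add: mconst_def meval_single monom_eval_def)

lemma mconst_1: "mconst 1 = 1"
  by (simp add: mconst_def)

lemma mconst_0 [simp]: "mconst 0 = 0"
  by (simp add: mconst_def)

lemma meval_1 [simp]: "meval F 1 = 1"
  by (metis mconst_1 meval_mconst)

section \<open>Indeterminates occurring in a polynomial\<close>

lemma mvars_diff_subset:
  assumes "mvars p \<subseteq> V" "mvars q \<subseteq> V"
  shows "mvars (p - q) \<subseteq> V"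
proof -
  have "mvars (p - q) \<subseteq> mvars p \<union> mvars q"
    using keys_diff[of p q] unfolding mvars_def by blast
  with assms show ?thesis by blast
qed

lemma mvars_mult_subset:
  assumes "mvars p \<subseteq> V" "mvars q \<subseteq> V"
  shows "mvars (p * q) \<subseteq> V"
proof
  fix i assume "i \<in> mvars (p * q)"
  then obtain m where "m \<in> Poly_Mapping.keys (p * q)" "i \<in> Poly_Mapping.keys m"
    by (auto simp: mvars_def)
  with keys_mult[of p q] obtain a b where "a \<in> Poly_Mapping.keys p" "b \<in> Poly_Mapping.keys q"
    "i \<in> Poly_Mapping.keys (a + b)"
    by blast
  then have "i \<in> mvars p \<union> mvars q"
    using Poly_Mapping.keys_add[of a b] by (auto simp: mvars_def)
  with assms show "i \<in> V" by blast
qed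

lemma mvars_0 [simp]: "mvars 0 = {}"
  by (simp add: mvars_def)

lemma mvars_mconst [simp]: "mvars (mconst c) = {}"
  by (simp add: mvars_def mconst_def)

lemma mvars_1 [simp]: "mvars 1 = {}"
  by (metis mconst_1 mvars_mconst)

lemma mvars_mvar [simp]: "mvars (mvar i) = {i}"
  by (simp add: mvars_def mvar_def)

lemma meval_cong:
  assumes "\<And>i. i \<in> mvars p \<Longrightarrow> F i = G i"
  shows "meval F p = meval G p"
proof -
  have "F i = G i" if "m \<in> Poly_Mapping.keys p" "i \<in> Poly_Mapping.keys m" for i m
    using that by (intro assms) (auto simp: mvars_def)
  then show ?thesis
    by (simp add: meval_def cong: prod.cong)
qed

section \<open>The characteristic polynomial as a continuant\<close>

text \<open>Index \<open>n\<close> stands for the leading block of size \<open>n\<close>, which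
  involves only the couplings 1 to \<open>n - 1\<close>; hence \<open>N\<close> couplings belong to
  index \<open>Suc N\<close>. The general ring covers real couplings and indeterminates
  alike.\<close>

fun continuant :: "(nat \<Rightarrow> 'a::comm_ring_1) \<Rightarrow> nat \<Rightarrow> 'a poly" where
  "continuant F 0 = 1"
| "continuant F (Suc 0) = [:0, 1:]"
| "continuant F (Suc (Suc n)) =
     [:0, 1:] * continuant F (Suc n) - [:F (Suc n) * F (Suc n):] * continuant F n"

definition jacobi_mat :: "(nat \<Rightarrow> 'a::comm_ring_1) \<Rightarrow> nat \<Rightarrow> 'a poly mat" where
  "jacobi_mat F n = mat n n (\<lambda>(i, j). if i = j then [:0, 1:] else if j = Suc i then [:F j:]
     else if i = Suc j then [:F i:] else 0)"

lemma det_jacobi_mat: "det (jacobi_mat F n) = continuant F n"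
proof (induction F n rule: continuant.induct)
  case (1 F)
  then show ?case by (simp add: jacobi_mat_def)
next
  case (2 F)
  then show ?case
    by (subst det_single) (auto simp: jacobi_mat_def)
next
  case (3 F n)
  let ?A = "jacobi_mat F (Suc (Suc n))"
  \<comment> \<open>The minor of the off-diagonal entry in the last row. The only nonzero entry its
    last column can have is the bottom one, so a second expansion, along that column, yields the
    squared coupling.\<close>
  let ?B = "mat_delete ?A (Suc n) n"
  have B: "?B \<in> carrier_mat (Suc n) (Suc n)"
    by (simp add: jacobi_mat_def mat_delete_def)
  have del_last: "mat_delete ?A (Suc n) (Suc n) = jacobi_mat F (Suc n)"
    by (rule eq_matI) (auto simp: jacobi_mat_def mat_delete_def)
  have del_both: "mat_delete ?B n n = jacobi_mat F n"
    by (rule eq_matI) (auto simp: jacobi_mat_def mat_delete_def)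
  have B_col: "?B $$ (i, n) = (if i = n then [:F (Suc n):] else 0)" if "i < Suc n" for i
    using that by (auto simp: jacobi_mat_def mat_delete_def)
  have "det ?B = (\<Sum>i<Suc n. ?B $$ (i, n) * cofactor ?B i n)"
    by (rule laplace_expansion_column[OF B]) simp
  also have "\<dots> = (\<Sum>i<Suc n. if i = n then [:F (Suc n):] * cofactor ?B n n else 0)"
    by (rule sum.cong) (auto simp: B_col)
  also have "\<dots> = [:F (Suc n):] * continuant F n"
    by (simp add: cofactor_def del_both 3)
  finally have det_B: "det ?B = [:F (Suc n):] * continuant F n" .
  have A_row: "?A $$ (Suc n, j) =
      (if j = n then [:F (Suc n):] else if j = Suc n then [:0, 1:] else 0)"
    if "j < Suc (Suc n)" for j
    using that by (auto simp: jacobi_mat_def)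
  have "det ?A = (\<Sum>j<Suc (Suc n). ?A $$ (Suc n, j) * cofactor ?A (Suc n) j)"
    by (rule laplace_expansion_row) (auto simp: jacobi_mat_def)
  also have "\<dots> = [:F (Suc n):] * cofactor ?A (Suc n) n + [:0, 1:] * cofactor ?A (Suc n) (Suc n)"
    by (simp add: A_row)
  also have "\<dots> = continuant F (Suc (Suc n))"
    by (simp add: cofactor_def del_last det_B 3)
  finally show ?case .
qed

lemma det_plus_hop_mat: "det_plus (hop_mat N F) = continuant F (Suc N)"
proof -
  have "map_mat (\<lambda>a. [:a:]) (hop_mat N F) + [:0, 1:] \<cdot>\<^sub>m 1\<^sub>m (dim_row (hop_mat N F))
      = jacobi_mat F (Suc N)"
    by (rule eq_matI) (auto simp: jacobi_mat_def hop_mat_def)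
  then show ?thesis
    by (simp add: det_plus_def det_jacobi_mat)
qed

text \<open>Evaluation respects products and differences, so it commutes with the
  recurrence.\<close>

lemma coeff_continuant_eq_meval:
  "coeff (continuant F n) j = meval F (coeff (continuant mvar n) j)"
proof (induction F n arbitrary: j rule: continuant.induct)
  case (3 F n)
  then show ?case
    by (cases j) (simp_all add: meval_diff meval_uminus meval_mult)
qed (simp_all add: coeff_pCons coeff_1 split: nat.split)

lemma mvars_coeff_continuant: "mvars (coeff (continuant mvar n) j) \<subseteq> {1..<n}"
proof (induction n arbitrary: j rule: induct_nat_012)
  case (ge2 n)
  let ?V = "{1..<Suc (Suc n)}"
  have IH: "mvars (coeff (continuant mvar n) i) \<subseteq> ?V"
    "mvars (coeff (continuant mvar (Suc n)) i) \<subseteq> ?V" for i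
    using ge2(1)[of i] ge2(2)[of i] by force+
  have "coeff (continuant mvar (Suc (Suc n))) j
      = (case j of 0 \<Rightarrow> 0 | Suc i \<Rightarrow> coeff (continuant mvar (Suc n)) i)
        - mvar (Suc n) * mvar (Suc n) * coeff (continuant mvar n) j"
    by (simp add: coeff_pCons)
  also have "mvars \<dots> \<subseteq> ?V"
    by (intro mvars_diff_subset mvars_mult_subset IH) (use IH in \<open>auto split: nat.split\<close>)
  finally show ?case .
qed (simp_all add: coeff_pCons split: nat.split)

text \<open>In the recurrence the first term raises degree and index by one, the second raises only
  the index, by two; both preserve the bound and the parity.\<close>

lemma coeff_continuant_eq_0:
  assumes "j > n \<or> odd (n + j)"
  shows "coeff (continuant F n) j = 0"
  using assms
proof (induction F n arbitrary: j rule: continuant.induct)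
  case (3 F n)
  then show ?case
    by (cases j) auto
qed (auto simp: coeff_pCons coeff_1 intro: odd_pos split: nat.split)

lemma coeff_continuant_self [simp]: "coeff (continuant F n) n = 1"
  by (induction F n rule: continuant.induct) (simp_all add: coeff_continuant_eq_0)

text \<open>The binomial coefficient counts the \<open>k\<close>-edge matchings of a path with \<open>j + 2k\<close> vertices.\<close>
lemma coeff_continuant_const:
  "coeff (continuant (\<lambda>_. t) (j + 2 * k)) j = (- (t * t)) ^ k * of_nat ((j + k) choose k)"
proof (induction "j + 2 * k" arbitrary: j k rule: less_induct)
  case less
  show ?case
  proof (cases k)
    case 0
    then show ?thesis by simp
  next
    case (Suc l)
    have IH2: "coeff (continuant (\<lambda>_. t) (j + 2 * l)) j = (- (t * t)) ^ l * of_nat ((j + l) choose l)"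
      using Suc by (intro less) auto
    show ?thesis
    proof (cases j)
      case 0
      then show ?thesis using Suc IH2 by simp
    next
      case (Suc i)
      have IH1: "coeff (continuant (\<lambda>_. t) (i + 2 * k)) i = (- (t * t)) ^ k * of_nat ((i + k) choose k)"
        using Suc by (intro less) auto
      \<comment> \<open>With constant couplings the recurrence is Pascal's rule:
        \<open>j + l = i + k\<close>, so the two terms carry \<open>(i + k) choose k\<close> and
        \<open>(i + k) choose l\<close>.\<close>
      show ?thesis
        using IH1 IH2 Suc \<open>k = Suc l\<close> by (simp add: algebra_simps)
    qed
  qed
qed

section \<open>Spectrum and target polynomial\<close>

text \<open>Evaluation at \<open>- e\<close> is a ring homomorphism, so it commutes with
  \<open>det\<close> and turns the polynomial matrix into \<open>A - e 1\<close>.\<close>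

lemma eigenvalue_iff_poly_det_plus:
  fixes A :: "'a::field mat"
  assumes A: "A \<in> carrier_mat n n"
  shows "eigenvalue A e \<longleftrightarrow> poly (det_plus A) (- e) = 0"
proof -
  have hom: "comm_ring_hom (\<lambda>p. poly p (- e))"
    by unfold_locales
  have "map_mat (\<lambda>p. poly p (- e)) (map_mat (\<lambda>a. [:a:]) A + [:0, 1:] \<cdot>\<^sub>m 1\<^sub>m (dim_row A))
      = char_matrix A e"
    using A by (intro eq_matI) (auto simp: char_matrix_def)
  then have "poly (det_plus A) (- e) = det (char_matrix A e)"
    unfolding det_plus_def by (simp only: comm_ring_hom.hom_det[OF hom, symmetric])
  with eigenvalue_det[OF A] show ?thesis by simp
qed

lemma poly_target_eq_0_iff: "poly (target_poly N E) x = 0 \<longleftrightarrow> - x \<in> E ` {1..N + 1}"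
proof -
  have "poly (target_poly N E) x = 0 \<longleftrightarrow> (\<exists>k\<in>{1..N + 1}. E k + x = 0)"
    by (simp add: target_poly_def poly_prod del: prod.cl_ivl_Suc)
  also have "\<dots> \<longleftrightarrow> (\<exists>k\<in>{1..N + 1}. - x = E k)"
    by (intro bex_cong) auto
  finally show ?thesis by (simp only: image_iff)
qed

lemma degree_target_poly: "degree (target_poly N E) = N + 1"
  unfolding target_poly_def by (subst degree_prod_eq_sum_degree) auto

lemma coeff_target_poly_top: "coeff (target_poly N E) (N + 1) = 1"
proof -
  have "lead_coeff (target_poly N E) = 1"
    unfolding target_poly_def by (simp add: lead_coeff_prod del: prod.cl_ivl_Suc)
  then show ?thesis by (simp only: degree_target_poly)
qed

text \<open>Replacing the variable by its negative permutes the linear factors up to sign, so the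
  polynomial is multiplied by \<open>(- 1) ^ (N + 1)\<close>; coefficients are then
  compared.\<close>

lemma coeff_target_poly_odd:
  assumes "inj_on E {1..N + 1}" and sym: "\<And>x. x \<in> E ` {1..N + 1} \<Longrightarrow> - x \<in> E ` {1..N + 1}"
    and "odd (N + 1 + j)"
  shows "coeff (target_poly N E) j = 0"
proof -
  let ?S = "E ` {1..N + 1}"
  \<comment> \<open>By injectivity the product runs over the set of values, on which negation is an
    involution.\<close>
  have target: "target_poly N E = (\<Prod>x\<in>?S. [:x, 1:])"
    unfolding target_poly_def using assms(1) by (simp add: prod.reindex)
  have "card ?S = N + 1"
    using assms(1) by (simp add: card_image)
  have "pcompose (target_poly N E) [:0, -1:] = (\<Prod>x\<in>?S. - [:- x, 1:])"
    unfolding target pcompose_prod by (simp add: pcompose_pCons)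
  also have "\<dots> = (- 1) ^ (N + 1) * (\<Prod>x\<in>?S. [:- x, 1:])"
    by (simp only: prod_uminus \<open>card ?S = N + 1\<close>)
  also have "(\<Prod>x\<in>?S. [:- x, 1:]) = (\<Prod>x\<in>?S. [:x, 1:])"
    by (rule prod.reindex_bij_witness[where i = uminus and j = uminus]) (use sym in auto)
  finally have pcompose: "pcompose (target_poly N E) [:0, -1:] = (- 1) ^ (N + 1) * target_poly N E"
    by (simp only: target)
  have "(- 1) ^ j * coeff (target_poly N E) j = coeff (pcompose (target_poly N E) [:0, -1:]) j"
    by (simp only: coeff_pcompose_linear)
  also have "\<dots> = (- 1) ^ (N + 1) * coeff (target_poly N E) j"
    unfolding pcompose by (cases "even (N + 1)")
      (simp_all only: uminus_power_if if_True if_False power_one mult_1 mult_minus1 coeff_minus)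
  finally have "(- 1) ^ j * coeff (target_poly N E) j = (- 1) ^ (N + 1) * coeff (target_poly N E) j" .
  moreover have "(- 1) ^ j = - ((- 1 :: real) ^ (N + 1))"
    using assms(3) by (cases "even j") auto
  ultimately show ?thesis by simp
qed

text \<open>The spectrum as a set forgets multiplicities, but \<open>N + 1\<close> distinct
  eigenvalues leave no room for repeated roots in degree \<open>N + 1\<close>.\<close>

lemma spectrum_hop_mat_iff:
  assumes "inj_on E {1..N + 1}"
  shows "spectrum (hop_mat N F) = E ` {1..N + 1} \<longleftrightarrow> det_plus (hop_mat N F) = target_poly N E"
proof
  let ?D = "det_plus (hop_mat N F)"
  have spec: "x \<in> spectrum (hop_mat N F) \<longleftrightarrow> poly ?D (- x) = 0" for x
    by (simp add: spectrum_def eigenvalue_iff_poly_det_plus[where n = "N + 1"] hop_mat_def)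
  {
    assume "?D = target_poly N E"
    then show "spectrum (hop_mat N F) = E ` {1..N + 1}"
      by (simp add: set_eq_iff spec poly_target_eq_0_iff)
  next
    assume S: "spectrum (hop_mat N F) = E ` {1..N + 1}"
    show "?D = target_poly N E"
    \<comment> \<open>Since the top coefficients agree, the difference has degree at most
      \<open>N\<close>, yet it vanishes at the \<open>N + 1\<close> negated eigenvalues.\<close>
    proof (rule poly_eqI_degree_lead_coeff)
      show "coeff ?D (N + 1) = coeff (target_poly N E) (N + 1)"
        by (simp only: coeff_target_poly_top) (simp add: det_plus_hop_mat)
      show "N + 1 \<le> card (uminus ` E ` {1..N + 1})"
        using assms by (simp add: card_image)
      show "degree ?D \<le> N + 1"
        by (rule degree_le) (simp add: det_plus_hop_mat coeff_continuant_eq_0)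
      show "degree (target_poly N E) \<le> N + 1"
        by (simp add: degree_target_poly)
      show "poly ?D x = poly (target_poly N E) x" if "x \<in> uminus ` E ` {1..N + 1}" for x
      proof -
        from that have x: "- x \<in> E ` {1..N + 1}" by auto
        with spec[of "- x"] S have "poly ?D x = 0" by simp
        with x poly_target_eq_0_iff[of N E x] show ?thesis by simp
      qed
    qed
  }
qed

section \<open>The equations\<close>

lemma coeff_det_plus_hop_mat: "coeff (det_plus (hop_mat N F)) j = meval F (coeff_poly N j)"
  unfolding coeff_poly_def det_plus_hop_mat by (rule coeff_continuant_eq_meval)

lemma meval_coeff_poly_const:
  assumes "2 * k \<le> N + 1"
  shows "meval (\<lambda>_. t) (coeff_poly N (N + 1 - 2 * k))
    = (- (t * t)) ^ k * of_nat ((N + 1 - k) choose k)"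
proof -
  have "N + 1 - 2 * k + 2 * k = Suc N" "N + 1 - 2 * k + k = N + 1 - k"
    using assms by auto
  with coeff_continuant_const[of t "N + 1 - 2 * k" k] show ?thesis
    by (simp add: coeff_det_plus_hop_mat[symmetric] det_plus_hop_mat)
qed

definition coeff_eq :: "nat \<Rightarrow> (nat \<Rightarrow> real) \<Rightarrow> nat \<Rightarrow> rmpoly" where
  "coeff_eq N E j = coeff_poly N j - mconst (coeff (target_poly N E) j)"

text \<open>Subtracting the value at the origin cancels the target coefficient, so the result does
  not depend on \<open>E\<close>. At the origin the coefficient polynomial gives 0 because
  \<open>k\<close> is positive.\<close>

lemma meval_coeff_eq_const_diff:
  assumes "1 \<le> k" "2 * k \<le> N + 1"
  shows "meval (\<lambda>_. t) (coeff_eq N E (N + 1 - 2 * k)) - meval (\<lambda>_. 0) (coeff_eq N E (N + 1 - 2 * k))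
    = (- (t * t)) ^ k * of_nat ((N + 1 - k) choose k)"
  using assms by (simp add: coeff_eq_def meval_diff meval_coeff_poly_const[simplified])

lemma mvars_coeff_eq:
  assumes "1 \<le> k" "2 * k \<le> N + 1"
  shows "mvars (coeff_eq N E (N + 1 - 2 * k)) \<noteq> {}"
proof
  let ?p = "coeff_eq N E (N + 1 - 2 * k)"
  assume "mvars ?p = {}"
  then have "meval (\<lambda>_. 1) ?p = meval (\<lambda>_. 0) ?p"
    by (intro meval_cong) auto
  \<comment> \<open>The difference is a binomial coefficient up to sign, nonzero since
    \<open>k \<le> N + 1 - k\<close>.\<close>
  with meval_coeff_eq_const_diff[OF assms, of 1 E] assms show False
    by simp
qed

lemma inj_on_coeff_eq: "inj_on (\<lambda>k. coeff_eq N E (N + 1 - 2 * k)) {1..(N + 1) div 2}"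
proof (rule inj_onI)
  fix k l
  assume k: "k \<in> {1..(N + 1) div 2}" and l: "l \<in> {1..(N + 1) div 2}"
    and eq: "coeff_eq N E (N + 1 - 2 * k) = coeff_eq N E (N + 1 - 2 * l)"
  define a b where "a = (- 1) ^ k * real ((N + 1 - k) choose k)"
    and "b = (- 1) ^ l * real ((N + 1 - l) choose l)"
  have bounds: "1 \<le> k" "2 * k \<le> N + 1" "1 \<le> l" "2 * l \<le> N + 1"
    using k l by auto
  have *: "(t * t) ^ k * a = (t * t) ^ l * b" for t
  proof -
    have "(- (t * t)) ^ k * real ((N + 1 - k) choose k) = (- (t * t)) ^ l * real ((N + 1 - l) choose l)"
      using meval_coeff_eq_const_diff[OF bounds(1,2), of t E]
        meval_coeff_eq_const_diff[OF bounds(3,4), of t E]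
      unfolding eq by (rule trans[OF sym])
    then show ?thesis
      unfolding power_minus[of "t * t"] a_def b_def by (simp only: mult_ac)
  qed
  \<comment> \<open>Equality at \<open>t = 1\<close> identifies the signed binomials;
    \<open>t = 2\<close> then separates the exponents.\<close>
  have "a = b"
    using *[of 1] by simp
  moreover have "4 ^ k * a = 4 ^ l * b"
    using *[of 2] by simp
  moreover have "b \<noteq> 0"
    using bounds by (simp add: b_def)
  ultimately have "(4 :: real) ^ k = 4 ^ l" by simp
  then show "k = l" by simp
qed

lemma coeff_eqs_eq:
  assumes "inj_on E {1..N + 1}" "\<And>x. x \<in> E ` {1..N + 1} \<Longrightarrow> - x \<in> E ` {1..N + 1}"
  shows "coeff_eqs N E = (\<lambda>k. coeff_eq N E (N + 1 - 2 * k)) ` {1..(N + 1) div 2}" (is "_ = ?R")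
proof (intro equalityI subsetI)
  fix p assume "p \<in> coeff_eqs N E"
  then obtain j where j: "p = coeff_eq N E j" "j \<le> N + 1" "p \<noteq> 0"
    by (auto simp: coeff_eqs_def coeff_eq_def)
  \<comment> \<open>In a degree of the wrong parity the equation reads 0 = 0, in the top degree 1 =
    1; both contradict \<open>p \<noteq> 0\<close>.\<close>
  have "even (N + 1 + j)"
  proof (rule ccontr)
    assume odd: "odd (N + 1 + j)"
    then have "coeff_poly N j = 0"
      by (simp add: coeff_poly_def det_plus_hop_mat coeff_continuant_eq_0)
    with j coeff_target_poly_odd[OF assms odd] show False
      by (simp add: coeff_eq_def)
  qed
  moreover have "j \<noteq> N + 1"
  proof
    assume "j = N + 1"
    with j show False
      using coeff_target_poly_top[of N E]
      by (simp add: coeff_eq_def coeff_poly_def det_plus_hop_mat mconst_1)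
  qed
  ultimately have "\<exists>k\<ge>1. N + 1 = j + 2 * k"
    using j(2) by presburger
  then obtain k where "k \<ge> 1" "N + 1 = j + 2 * k" by blast
  then have "j = N + 1 - 2 * k" "k \<in> {1..(N + 1) div 2}" by auto
  with j(1) show "p \<in> ?R" by blast
next
  fix p assume "p \<in> ?R"
  then obtain k where k: "1 \<le> k" "2 * k \<le> N + 1" "p = coeff_eq N E (N + 1 - 2 * k)"
    by auto
  moreover have "p \<noteq> 0"
    using mvars_coeff_eq[OF k(1,2), of E] k(3) by auto
  ultimately show "p \<in> coeff_eqs N E"
    by (auto simp: coeff_eqs_def coeff_eq_def)
qed

lemma det_plus_eq_target_iff:
  "det_plus (hop_mat N F) = target_poly N E \<longleftrightarrow> (\<forall>p\<in>coeff_eqs N E. meval F p = 0)"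
proof -
  have "det_plus (hop_mat N F) = target_poly N E
      \<longleftrightarrow> (\<forall>j. coeff (det_plus (hop_mat N F)) j = coeff (target_poly N E) j)"
    by (simp add: poly_eq_iff)
  also have "\<dots> \<longleftrightarrow> (\<forall>j\<le>N + 1. coeff (det_plus (hop_mat N F)) j = coeff (target_poly N E) j)"
  proof -
    have "coeff (det_plus (hop_mat N F)) j = coeff (target_poly N E) j" if "j > N + 1" for j
      using that
      by (simp add: det_plus_hop_mat coeff_continuant_eq_0 coeff_eq_0 degree_target_poly)
    then show ?thesis by (meson not_le)
  qed
  also have "\<dots> \<longleftrightarrow> (\<forall>j\<le>N + 1. meval F (coeff_eq N E j) = 0)"
    by (simp add: coeff_eq_def coeff_det_plus_hop_mat meval_diff)
  \<comment> \<open>Removing the zero polynomial discards only an equation satisfied by every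
    \<open>F\<close>.\<close>
  also have "\<dots> \<longleftrightarrow> (\<forall>p\<in>coeff_eqs N E. meval F p = 0)"
    unfolding coeff_eqs_def coeff_eq_def by (auto; metis meval_0)
  finally show ?thesis .
qed

theorem mainTheorem3:
  fixes N :: nat and E :: "nat \<Rightarrow> real" and \<Sigma> :: "real set"
  assumes "N \<ge> 1"
    and "\<Sigma> = E ` {1..N + 1}" and "inj_on E {1..N + 1}"
    and "\<And>x. x \<in> \<Sigma> \<Longrightarrow> - x \<in> \<Sigma>"
  shows "(\<forall>j. mvars (coeff_poly N j) \<subseteq> {1..N}) \<and>
    (\<forall>F\<in>couplings N. \<forall>j. coeff (det_plus (hop_mat N F)) j = meval F (coeff_poly N j)) \<and>
    (\<forall>F\<in>couplings N. det_plus (hop_mat N F) = target_poly N E \<longleftrightarrow>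
       (\<forall>p\<in>coeff_eqs N E. meval F p = 0)) \<and>
    (\<forall>p\<in>coeff_eqs N E. mvars p \<noteq> {}) \<and>
    card (coeff_eqs N E) = (N + 1) div 2 \<and>
    N - (N + 1) div 2 = N div 2 \<and>
    counting_surface N (coeff_eqs N E) (N div 2) {F \<in> couplings N. spectrum (hop_mat N F) = \<Sigma>}"
proof -
  have eqs: "coeff_eqs N E = (\<lambda>k. coeff_eq N E (N + 1 - 2 * k)) ` {1..(N + 1) div 2}"
    using assms by (intro coeff_eqs_eq) auto
  have vars: "mvars (coeff_poly N j) \<subseteq> {1..N}" for j
    unfolding coeff_poly_def det_plus_hop_mat using mvars_coeff_continuant[of "Suc N" j]
    by (simp add: atLeastLessThanSuc_atLeastAtMost)
  have eq_vars: "mvars p \<subseteq> {1..N}" if "p \<in> coeff_eqs N E" for p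
    using that vars unfolding coeff_eqs_def
    by (elim DiffE CollectE exE conjE) (simp only:, rule mvars_diff_subset, auto)
  have nonconst: "mvars p \<noteq> {}" if "p \<in> coeff_eqs N E" for p
  proof -
    from that obtain k where "1 \<le> k" "2 * k \<le> N + 1" "p = coeff_eq N E (N + 1 - 2 * k)"
      unfolding eqs by force
    then show ?thesis using mvars_coeff_eq by blast
  qed
  have card: "card (coeff_eqs N E) = (N + 1) div 2"
    unfolding eqs by (simp add: card_image inj_on_coeff_eq[simplified])
  have "finite (coeff_eqs N E)"
    unfolding eqs by simp
  \<comment> \<open>The count is \<open>(N + 1) div 2 + N div 2 = N\<close>. The solution set
    follows by passing from the spectrum to equality of polynomials and from there to the
    equations.\<close>
  then have "counting_surface N (coeff_eqs N E) (N div 2)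
      {F \<in> couplings N. spectrum (hop_mat N F) = \<Sigma>}"
    using eq_vars card spectrum_hop_mat_iff[OF assms(3)] det_plus_eq_target_iff[of N _ E]
    by (simp add: counting_surface_def assms(2) card)
  with vars nonconst card show ?thesis
    by (simp add: coeff_det_plus_hop_mat det_plus_eq_target_iff)
qed

end
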